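(* Let $\Gamma\rightrightarrows M$ be a groupoid with source $s'$, target $t'$ and identity map $\epsilon':M\to\Gamma$, and let $X\rightrightarrows M$ be a precategory with source $s$, target $t$ and identity map $\epsilon:M\to X$. Suppose that there exists a morphism of precategories $p:X\to\Gamma$, i.e. a map such that $s'\circ p=s$, $t'\circ p=t$ and $p\circ\epsilon=\epsilon'$. Suppose that the group $\mathrm{Bis}(\Gamma)$ of bisections of $\Gamma$ acts on $X$ in such a manner that $$p(\Sigma\cdot x)=\Sigma\star p(x)\star\Sigma^{-1}\qquad\text{for all }\Sigma\in\mathrm{Bis}(\Gamma)\text{ and all }x\in X,$$ while $$p(\Sigma)\cdot 1_m=1_m\qquad\text{for all bisections }\Sigma\text{ of }X\text{ and all }m\in M.$$ Then the prescription $\mathrm{T}\rhd x:=p(\mathrm{T})\cdot x$, for all $x\in X$ and all bisections $\mathrm{T}$ of $X$, defines a pointed rackoid structure on $X$.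
   Context: All structures are set-theoretic (no smoothness). A precategory $X\rightrightarrows M$ is a pair of sets $(X,M)$ with surjective maps $s,t:X\to M$ and a map $\epsilon:M\to X$ with $s\circ\epsilon=t\circ\epsilon=\mathrm{id}_M$; write $1_m=\epsilon(m)$ and $1_M=\epsilon(M)$. All precategories are assumed to admit bisections. A bisection is a subset $\Sigma$ of the total space on which both source and target restrict to bijections onto $M$; equivalently, a map $\sigma$ from $M$ to the total space that is right inverse to the source map and for which $\underline{\sigma}:=(\text{target})\circ\sigma$ is a bijection of $M$. The image $p(\mathrm{T})$ of a bisection $\mathrm{T}$ of $X$ is a bisection of $\Gamma$. Groupoid convention: products are read from left to right, i.e. $gh$ is defined if and only if $t'(g)=s'(h)$. For subsets $A,B\subset\Gamma$, $A\star B$ is the set of all products $ab$ of composable elements $a\in A$, $b\in B$. Bisections of $\Gamma$ form a group $\mathrm{Bis}(\Gamma)$ under $\star$. For $\gamma\in\Gamma$, $\Sigma\star\gamma\star\Sigma^{-1}$ denotes the unique element of $\Sigma\star\{\gamma\}\star\Sigma^{-1}$, namely $\sigma\big(\underline{\sigma}^{-1}(s'(\gamma))\big)\,\gamma\,\sigma\big(\underline{\sigma}^{-1}(t'(\gamma))\big)^{-1}$. A pointed (unital) rackoid is a precategory $X\rightrightarrows M$ with a composition law $(\Sigma,x)\mapsto\Sigma\rhd x\in X$, for bisections $\Sigma$ of $X$ and $x\in X$, such that $s(\Sigma\rhd x)=\underline{\sigma}(s(x))$ and $t(\Sigma\rhd x)=\underline{\sigma}(t(x))$; each map $\Sigma\rhd-:X\to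 X$ is a bijection; $\Sigma\rhd(\mathrm{T}\rhd x)=(\Sigma\rhd\mathrm{T})\rhd(\Sigma\rhd x)$ for all bisections $\Sigma,\mathrm{T}$ and all $x\in X$, where $\Sigma\rhd\mathrm{T}=\{\Sigma\rhd y:y\in\mathrm{T}\}$; and $1_M\rhd x=x$ for all $x\in X$, $\Sigma\rhd 1_m=1_{\underline{\sigma}(m)}$ for all $m\in M$. *)

theory Defs
  imports "HOL-Algebra.Group_Action"
begin

record ('m, 'x) precat =
  objs :: "'m set"
  arrs :: "'x set"
  src :: "'x \<Rightarrow> 'm"
  tgt :: "'x \<Rightarrow> 'm"
  ident :: "'m \<Rightarrow> 'x"

text \<open>The standing assumption that bisections exist is automatic: the unit section is
  always one, see \<open>bisection_ident\<close> below.\<close>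

definition precategory :: "('m, 'x, 'z) precat_scheme \<Rightarrow> bool" where
  "precategory C \<longleftrightarrow>
     src C \<in> arrs C \<rightarrow> objs C \<and> tgt C \<in> arrs C \<rightarrow> objs C \<and>
     ident C \<in> objs C \<rightarrow> arrs C \<and>
     src C ` arrs C = objs C \<and> tgt C ` arrs C = objs C \<and>
     (\<forall>m\<in>objs C. src C (ident C m) = m \<and> tgt C (ident C m) = m)"

definition bisection :: "('m, 'x, 'z) precat_scheme \<Rightarrow> 'x set \<Rightarrow> bool" where
  "bisection C S \<longleftrightarrow> S \<subseteq> arrs C \<and>
     bij_betw (src C) S (objs C) \<and> bij_betw (tgt C) S (objs C)"

text \<open>The section of the source map whose image is \<open>S\<close>, and the induced bijection of the
  object set.\<close>

definition bis_section :: "('m, 'x, 'z) precat_scheme \<Rightarrow> 'x set \<Rightarrow> 'm \<Rightarrow> 'x" where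
  "bis_section C S = the_inv_into S (src C)"

definition bis_base :: "('m, 'x, 'z) precat_scheme \<Rightarrow> 'x set \<Rightarrow> 'm \<Rightarrow> 'm" where
  "bis_base C S m = tgt C (bis_section C S m)"

text \<open>Morphisms cover the identity of a common object set.\<close>

definition precat_morphism ::
  "('m, 'x, 'z) precat_scheme \<Rightarrow> ('m, 'g, 'w) precat_scheme \<Rightarrow> ('x \<Rightarrow> 'g) \<Rightarrow> bool" where
  "precat_morphism C D p \<longleftrightarrow> objs C = objs D \<and> p \<in> arrs C \<rightarrow> arrs D \<and>
     (\<forall>x\<in>arrs C. src D (p x) = src C x \<and> tgt D (p x) = tgt C x) \<and>
     (\<forall>m\<in>objs C. p (ident C m) = ident D m)"

text \<open>Products are read from left to right: \<open>gmul \<Gamma> g h\<close> is meaningful only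
  if \<open>tgt \<Gamma> g = src \<Gamma> h\<close>.\<close>

record ('m, 'g) gpd = "('m, 'g) precat" +
  gmul :: "'g \<Rightarrow> 'g \<Rightarrow> 'g"

definition groupoid :: "('m, 'g, 'z) gpd_scheme \<Rightarrow> bool" where
  "groupoid \<Gamma> \<longleftrightarrow> precategory \<Gamma> \<and>
     (\<forall>g\<in>arrs \<Gamma>. \<forall>h\<in>arrs \<Gamma>. tgt \<Gamma> g = src \<Gamma> h \<longrightarrow>
        gmul \<Gamma> g h \<in> arrs \<Gamma> \<and>
        src \<Gamma> (gmul \<Gamma> g h) = src \<Gamma> g \<and> tgt \<Gamma> (gmul \<Gamma> g h) = tgt \<Gamma> h) \<and>
     (\<forall>g\<in>arrs \<Gamma>. \<forall>h\<in>arrs \<Gamma>. \<forall>k\<in>arrs \<Gamma>. tgt \<Gamma> g = src \<Gamma> h \<longrightarrow> tgt \<Gamma> h = src \<Gamma> k \<longrightarrow>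
        gmul \<Gamma> (gmul \<Gamma> g h) k = gmul \<Gamma> g (gmul \<Gamma> h k)) \<and>
     (\<forall>g\<in>arrs \<Gamma>. gmul \<Gamma> (ident \<Gamma> (src \<Gamma> g)) g = g \<and> gmul \<Gamma> g (ident \<Gamma> (tgt \<Gamma> g)) = g) \<and>
     (\<forall>g\<in>arrs \<Gamma>. \<exists>h\<in>arrs \<Gamma>. src \<Gamma> h = tgt \<Gamma> g \<and> tgt \<Gamma> h = src \<Gamma> g \<and>
        gmul \<Gamma> g h = ident \<Gamma> (src \<Gamma> g) \<and> gmul \<Gamma> h g = ident \<Gamma> (tgt \<Gamma> g))"

definition star :: "('m, 'g, 'z) gpd_scheme \<Rightarrow> 'g set \<Rightarrow> 'g set \<Rightarrow> 'g set" where
  "star \<Gamma> A B = {gmul \<Gamma> a b | a b. a \<in> A \<and> b \<in> B \<and> tgt \<Gamma> a = src \<Gamma> b}"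

definition Bis :: "('m, 'g, 'z) gpd_scheme \<Rightarrow> 'g set monoid" where
  "Bis \<Gamma> = \<lparr>carrier = {S. bisection \<Gamma> S}, mult = star \<Gamma>, one = ident \<Gamma> ` objs \<Gamma>\<rparr>"

text \<open>The unique element of \<open>S \<star> {g} \<star> S\<^sup>-\<^sup>1\<close>; see \<open>bis_conj_eq\<close> for the explicit formula.\<close>

definition bis_conj :: "('m, 'g, 'z) gpd_scheme \<Rightarrow> 'g set \<Rightarrow> 'g \<Rightarrow> 'g" where
  "bis_conj \<Gamma> S g = (THE d. d \<in> star \<Gamma> (star \<Gamma> S {g}) (inv\<^bsub>Bis \<Gamma>\<^esub> S))"

text \<open>The law \<open>act\<close> is only constrained on bisections of \<open>C\<close> and arrows of \<open>C\<close>.\<close>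

definition pointed_rackoid ::
  "('m, 'x, 'z) precat_scheme \<Rightarrow> ('x set \<Rightarrow> 'x \<Rightarrow> 'x) \<Rightarrow> bool" where
  "pointed_rackoid C act \<longleftrightarrow> precategory C \<and>
     (\<forall>S. bisection C S \<longrightarrow>
        bij_betw (act S) (arrs C) (arrs C) \<and>
        (\<forall>x\<in>arrs C. src C (act S x) = bis_base C S (src C x) \<and>
                    tgt C (act S x) = bis_base C S (tgt C x)) \<and>
        (\<forall>m\<in>objs C. act S (ident C m) = ident C (bis_base C S m))) \<and>
     (\<forall>S T. bisection C S \<longrightarrow> bisection C T \<longrightarrow>
        (\<forall>x\<in>arrs C. act S (act T x) = act (act S ` T) (act S x))) \<and>
     (\<forall>x\<in>arrs C. act (ident C ` objs C) x = x)"

lemma bisection_ident: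
  assumes "precategory C"
  shows "bisection C (ident C ` objs C)"
proof -
  have a: "src C (ident C m) = m" "tgt C (ident C m) = m" "ident C m \<in> arrs C"
    if "m \<in> objs C" for m
    using assms that by (auto simp: precategory_def)
  have "bij_betw (src C) (ident C ` objs C) (objs C)"
    by (rule bij_betw_byWitness[where f' = "ident C"]) (use a in auto)
  moreover have "bij_betw (tgt C) (ident C ` objs C) (objs C)"
    by (rule bij_betw_byWitness[where f' = "ident C"]) (use a in auto)
  ultimately show ?thesis using a(3) by (auto simp: bisection_def)
qed

lemma bisection_image:
  assumes "precat_morphism C D p" "bisection C S"
  shows "bisection D (p ` S)"
proof -
  have sub: "S \<subseteq> arrs C" using assms(2) by (simp add: bisection_def)
  have p: "src D (p x) = src C x" "tgt D (p x) = tgt C x" "p x \<in> arrs D" if "x \<in> S" for x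
    using assms(1) sub that by (auto simp: precat_morphism_def)
  have ob: "objs C = objs D" using assms(1) by (simp add: precat_morphism_def)
  have *: "bij_betw f (p ` S) (objs D)"
    if bij: "bij_betw g S (objs C)" and fg: "\<And>x. x \<in> S \<Longrightarrow> f (p x) = g x" for f g
  proof -
    have "f ` p ` S = g ` S" using fg by (simp add: image_image cong: image_cong)
    moreover have "inj_on f (p ` S)"
    proof (rule inj_onI)
      fix u v assume "u \<in> p ` S" "v \<in> p ` S" "f u = f v"
      then obtain x y where "x \<in> S" "y \<in> S" "u = p x" "v = p y" "g x = g y"
        using fg by auto
      then show "u = v" using bij_betw_imp_inj_on[OF bij] by (auto dest: inj_onD)
    qed
    ultimately show ?thesis using bij ob by (simp add: bij_betw_def)
  qed
  have "bij_betw (src C) S (objs C)" "bij_betw (tgt C) S (objs C)"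
    using assms(2) by (simp_all add: bisection_def)
  then have "bij_betw (src D) (p ` S) (objs D)" "bij_betw (tgt D) (p ` S) (objs D)"
    using p *[of "src C" "src D"] *[of "tgt C" "tgt D"] by blast+
  moreover have "p ` S \<subseteq> arrs D" using p(3) by blast
  ultimately show ?thesis unfolding bisection_def by blast
qed

lemma bis_section:
  assumes "bisection C S" "m \<in> objs C"
  shows "bis_section C S m \<in> S" "src C (bis_section C S m) = m"
  using assms the_inv_into_into[of "src C" S m S] f_the_inv_into_f[of "src C" S m]
  by (auto simp: bisection_def bij_betw_def bis_section_def)

lemma bisection_src_eqD:
  "bisection C S \<Longrightarrow> x \<in> S \<Longrightarrow> y \<in> S \<Longrightarrow> src C x = src C y \<Longrightarrow> x = y"
  by (auto simp: bisection_def bij_betw_def inj_on_def)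

lemma bisection_tgt_eqD:
  "bisection C S \<Longrightarrow> x \<in> S \<Longrightarrow> y \<in> S \<Longrightarrow> tgt C x = tgt C y \<Longrightarrow> x = y"
  by (auto simp: bisection_def bij_betw_def inj_on_def)

lemma bisection_arrs: "bisection C S \<Longrightarrow> x \<in> S \<Longrightarrow> x \<in> arrs C"
  by (auto simp: bisection_def)

lemma bisection_src_ex: "bisection C S \<Longrightarrow> m \<in> objs C \<Longrightarrow> \<exists>x\<in>S. src C x = m"
  by (metis bisection_def bij_betw_def imageE)

lemma bisection_tgt_ex: "bisection C S \<Longrightarrow> m \<in> objs C \<Longrightarrow> \<exists>x\<in>S. tgt C x = m"
  by (metis bisection_def bij_betw_def imageE)

lemma bisectionI:
  assumes "precategory C" "\<And>x. x \<in> S \<Longrightarrow> x \<in> arrs C"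
    and "\<And>x y. x \<in> S \<Longrightarrow> y \<in> S \<Longrightarrow> src C x = src C y \<Longrightarrow> x = y"
    and "\<And>x y. x \<in> S \<Longrightarrow> y \<in> S \<Longrightarrow> tgt C x = tgt C y \<Longrightarrow> x = y"
    and "\<And>m. m \<in> objs C \<Longrightarrow> \<exists>x\<in>S. src C x = m"
    and "\<And>m. m \<in> objs C \<Longrightarrow> \<exists>x\<in>S. tgt C x = m"
  shows "bisection C S"
proof -
  have "src C ` S = objs C" "tgt C ` S = objs C"
    using assms(1,2,5,6) by (auto simp: precategory_def image_iff Pi_iff) metis+
  then show ?thesis using assms(2-4) by (auto simp: bisection_def bij_betw_def inj_on_def)
qed

context
  fixes \<Gamma> :: "('m, 'g, 'z) gpd_scheme"
  assumes G: "groupoid \<Gamma>"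
begin

lemma gpd_precat: "precategory \<Gamma>" using G by (simp add: groupoid_def)

lemma gpd_objs: "g \<in> arrs \<Gamma> \<Longrightarrow> src \<Gamma> g \<in> objs \<Gamma>" "g \<in> arrs \<Gamma> \<Longrightarrow> tgt \<Gamma> g \<in> objs \<Gamma>"
  using gpd_precat by (auto simp: precategory_def)

lemma gpd_ident:
  "m \<in> objs \<Gamma> \<Longrightarrow> ident \<Gamma> m \<in> arrs \<Gamma>"
  "m \<in> objs \<Gamma> \<Longrightarrow> src \<Gamma> (ident \<Gamma> m) = m" "m \<in> objs \<Gamma> \<Longrightarrow> tgt \<Gamma> (ident \<Gamma> m) = m"
  using gpd_precat by (auto simp: precategory_def)

lemma gpd_comp:
  assumes "g \<in> arrs \<Gamma>" "h \<in> arrs \<Gamma>" "tgt \<Gamma> g = src \<Gamma> h"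
  shows "gmul \<Gamma> g h \<in> arrs \<Gamma>" "src \<Gamma> (gmul \<Gamma> g h) = src \<Gamma> g" "tgt \<Gamma> (gmul \<Gamma> g h) = tgt \<Gamma> h"
  using G assms by (auto simp: groupoid_def)

lemma gpd_assoc:
  "\<lbrakk>g \<in> arrs \<Gamma>; h \<in> arrs \<Gamma>; k \<in> arrs \<Gamma>; tgt \<Gamma> g = src \<Gamma> h; tgt \<Gamma> h = src \<Gamma> k\<rbrakk>
    \<Longrightarrow> gmul \<Gamma> (gmul \<Gamma> g h) k = gmul \<Gamma> g (gmul \<Gamma> h k)"
  using G by (auto simp: groupoid_def)

lemma gpd_unit:
  "g \<in> arrs \<Gamma> \<Longrightarrow> gmul \<Gamma> (ident \<Gamma> (src \<Gamma> g)) g = g"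
  "g \<in> arrs \<Gamma> \<Longrightarrow> gmul \<Gamma> g (ident \<Gamma> (tgt \<Gamma> g)) = g"
  using G by (auto simp: groupoid_def)

definition inverse_in :: "'g \<Rightarrow> 'g \<Rightarrow> bool" where
  "inverse_in g h \<longleftrightarrow> h \<in> arrs \<Gamma> \<and> src \<Gamma> h = tgt \<Gamma> g \<and> tgt \<Gamma> h = src \<Gamma> g \<and>
     gmul \<Gamma> g h = ident \<Gamma> (src \<Gamma> g) \<and> gmul \<Gamma> h g = ident \<Gamma> (tgt \<Gamma> g)"

lemma inverse_in_ex: "g \<in> arrs \<Gamma> \<Longrightarrow> \<exists>h. inverse_in g h"
  using G unfolding groupoid_def inverse_in_def by blast

lemma inverse_in_unique:
  assumes "g \<in> arrs \<Gamma>" "inverse_in g h" "inverse_in g k"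
  shows "h = k"
proof -
  have "h = gmul \<Gamma> h (gmul \<Gamma> g k)"
    using assms gpd_unit(2)[of h] by (simp add: inverse_in_def)
  also have "\<dots> = gmul \<Gamma> (gmul \<Gamma> h g) k"
    using assms gpd_assoc[of h g k] by (simp add: inverse_in_def)
  also have "\<dots> = k" using assms gpd_unit(1)[of k] by (simp add: inverse_in_def)
  finally show ?thesis .
qed

lemma star_bisection:
  assumes "bisection \<Gamma> S" "bisection \<Gamma> T"
  shows "bisection \<Gamma> (star \<Gamma> S T)"
proof (rule bisectionI[OF gpd_precat])
  note arr = bisection_arrs[OF assms(1)] bisection_arrs[OF assms(2)]
  show "x \<in> arrs \<Gamma>" if "x \<in> star \<Gamma> S T" for x
    using that arr gpd_comp by (auto simp: star_def)
  show "x = y" if xy: "x \<in> star \<Gamma> S T" "y \<in> star \<Gamma> S T" and eq: "src \<Gamma> x = src \<Gamma> y" for x y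
  proof -
    obtain a b c d where h: "a \<in> S" "b \<in> T" "tgt \<Gamma> a = src \<Gamma> b" "x = gmul \<Gamma> a b"
      "c \<in> S" "d \<in> T" "tgt \<Gamma> c = src \<Gamma> d" "y = gmul \<Gamma> c d"
      using xy by (auto simp: star_def)
    have "a = c" using h eq gpd_comp arr bisection_src_eqD[OF assms(1)] by metis
    moreover from this have "b = d" using h bisection_src_eqD[OF assms(2)] by metis
    ultimately show ?thesis using h by simp
  qed
  show "x = y" if xy: "x \<in> star \<Gamma> S T" "y \<in> star \<Gamma> S T" and eq: "tgt \<Gamma> x = tgt \<Gamma> y" for x y
  proof -
    obtain a b c d where h: "a \<in> S" "b \<in> T" "tgt \<Gamma> a = src \<Gamma> b" "x = gmul \<Gamma> a b"
      "c \<in> S" "d \<in> T" "tgt \<Gamma> c = src \<Gamma> d" "y = gmul \<Gamma> c d"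
      using xy by (auto simp: star_def)
    have "b = d" using h eq gpd_comp arr bisection_tgt_eqD[OF assms(2)] by metis
    moreover from this have "a = c" using h bisection_tgt_eqD[OF assms(1)] by metis
    ultimately show ?thesis using h by simp
  qed
  show "\<exists>x\<in>star \<Gamma> S T. src \<Gamma> x = m" if m: "m \<in> objs \<Gamma>" for m
  proof -
    obtain a where a: "a \<in> S" "src \<Gamma> a = m" using bisection_src_ex[OF assms(1) m] by blast
    obtain b where b: "b \<in> T" "src \<Gamma> b = tgt \<Gamma> a"
      using bisection_src_ex[OF assms(2) gpd_objs(2)[OF arr(1)[OF a(1)]]] by blast
    have "gmul \<Gamma> a b \<in> star \<Gamma> S T" using a b by (force simp: star_def)
    moreover have "src \<Gamma> (gmul \<Gamma> a b) = m" using a b arr gpd_comp(2)[of a b] by simp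
    ultimately show ?thesis by blast
  qed
  show "\<exists>x\<in>star \<Gamma> S T. tgt \<Gamma> x = m" if m: "m \<in> objs \<Gamma>" for m
  proof -
    obtain b where b: "b \<in> T" "tgt \<Gamma> b = m" using bisection_tgt_ex[OF assms(2) m] by blast
    obtain a where a: "a \<in> S" "tgt \<Gamma> a = src \<Gamma> b"
      using bisection_tgt_ex[OF assms(1) gpd_objs(1)[OF arr(2)[OF b(1)]]] by blast
    have "gmul \<Gamma> a b \<in> star \<Gamma> S T" using a b by (force simp: star_def)
    moreover have "tgt \<Gamma> (gmul \<Gamma> a b) = m" using a b arr gpd_comp(3)[of a b] by simp
    ultimately show ?thesis by blast
  qed
qed

lemma star_assoc:
  assumes "A \<subseteq> arrs \<Gamma>" "B \<subseteq> arrs \<Gamma>" "C \<subseteq> arrs \<Gamma>"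
  shows "star \<Gamma> (star \<Gamma> A B) C = star \<Gamma> A (star \<Gamma> B C)"
proof (rule Set.set_eqI, rule iffI)
  fix x assume "x \<in> star \<Gamma> (star \<Gamma> A B) C"
  then obtain a b c where h: "a \<in> A" "b \<in> B" "c \<in> C" "tgt \<Gamma> a = src \<Gamma> b"
    "tgt \<Gamma> (gmul \<Gamma> a b) = src \<Gamma> c" "x = gmul \<Gamma> (gmul \<Gamma> a b) c"
    by (auto simp: star_def)
  have ar: "a \<in> arrs \<Gamma>" "b \<in> arrs \<Gamma>" "c \<in> arrs \<Gamma>" using h assms by auto
  have bc: "tgt \<Gamma> b = src \<Gamma> c" using h gpd_comp(3)[OF ar(1,2)] by simp
  have "x = gmul \<Gamma> a (gmul \<Gamma> b c)" using h bc gpd_assoc[OF ar] by simp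
  moreover have "tgt \<Gamma> a = src \<Gamma> (gmul \<Gamma> b c)" using h bc gpd_comp(2)[OF ar(2,3)] by simp
  ultimately show "x \<in> star \<Gamma> A (star \<Gamma> B C)" using h(1-3) bc unfolding star_def by blast
next
  fix x assume "x \<in> star \<Gamma> A (star \<Gamma> B C)"
  then obtain a b c where h: "a \<in> A" "b \<in> B" "c \<in> C" "tgt \<Gamma> b = src \<Gamma> c"
    "tgt \<Gamma> a = src \<Gamma> (gmul \<Gamma> b c)" "x = gmul \<Gamma> a (gmul \<Gamma> b c)"
    by (auto simp: star_def)
  have ar: "a \<in> arrs \<Gamma>" "b \<in> arrs \<Gamma>" "c \<in> arrs \<Gamma>" using h assms by auto
  have ab: "tgt \<Gamma> a = src \<Gamma> b" using h gpd_comp(2)[OF ar(2,3)] by simp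
  have "x = gmul \<Gamma> (gmul \<Gamma> a b) c" using h ab gpd_assoc[OF ar] by simp
  moreover have "tgt \<Gamma> (gmul \<Gamma> a b) = src \<Gamma> c" using h ab gpd_comp(3)[OF ar(1,2)] by simp
  ultimately show "x \<in> star \<Gamma> (star \<Gamma> A B) C" using h(1-3) ab unfolding star_def by blast
qed

lemma star_one:
  assumes "A \<subseteq> arrs \<Gamma>"
  shows "star \<Gamma> (ident \<Gamma> ` objs \<Gamma>) A = A" "star \<Gamma> A (ident \<Gamma> ` objs \<Gamma>) = A"
proof -
  have "a \<in> star \<Gamma> (ident \<Gamma> ` objs \<Gamma>) A \<and> a \<in> star \<Gamma> A (ident \<Gamma> ` objs \<Gamma>)" if "a \<in> A" for a
  proof -
    have a: "a \<in> arrs \<Gamma>" using assms that by blast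
    have "a = gmul \<Gamma> (ident \<Gamma> (src \<Gamma> a)) a" "tgt \<Gamma> (ident \<Gamma> (src \<Gamma> a)) = src \<Gamma> a"
      "a = gmul \<Gamma> a (ident \<Gamma> (tgt \<Gamma> a))" "tgt \<Gamma> a = src \<Gamma> (ident \<Gamma> (tgt \<Gamma> a))"
      using a gpd_unit gpd_ident gpd_objs by auto
    then show ?thesis using that gpd_objs[OF a] unfolding star_def by blast
  qed
  moreover have "x \<in> A" if x: "x \<in> star \<Gamma> (ident \<Gamma> ` objs \<Gamma>) A" for x
  proof -
    obtain m a where "m \<in> objs \<Gamma>" "a \<in> A" "tgt \<Gamma> (ident \<Gamma> m) = src \<Gamma> a" "x = gmul \<Gamma> (ident \<Gamma> m) a"
      using x by (auto simp: star_def)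
    then show ?thesis using gpd_ident(3) gpd_unit(1)[of a] assms by (metis subsetD)
  qed
  moreover have "x \<in> A" if x: "x \<in> star \<Gamma> A (ident \<Gamma> ` objs \<Gamma>)" for x
  proof -
    obtain m a where "m \<in> objs \<Gamma>" "a \<in> A" "tgt \<Gamma> a = src \<Gamma> (ident \<Gamma> m)" "x = gmul \<Gamma> a (ident \<Gamma> m)"
      using x by (auto simp: star_def)
    then show ?thesis using gpd_ident(2) gpd_unit(2)[of a] assms by (metis subsetD)
  qed
  ultimately show "star \<Gamma> (ident \<Gamma> ` objs \<Gamma>) A = A" "star \<Gamma> A (ident \<Gamma> ` objs \<Gamma>) = A"
    by blast+
qed

definition inverses :: "'g set \<Rightarrow> 'g set" where
  "inverses S = {h. \<exists>g\<in>S. inverse_in g h}"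

lemma inverses_bisection:
  assumes "bisection \<Gamma> S"
  shows "bisection \<Gamma> (inverses S)"
proof (rule bisectionI[OF gpd_precat])
  note arr = bisection_arrs[OF assms]
  show "x \<in> arrs \<Gamma>" if "x \<in> inverses S" for x
    using that by (auto simp: inverses_def inverse_in_def)
  show "x = y" if xy: "x \<in> inverses S" "y \<in> inverses S" and eq: "src \<Gamma> x = src \<Gamma> y" for x y
  proof -
    obtain g h where h: "g \<in> S" "inverse_in g x" "h \<in> S" "inverse_in h y"
      using xy by (auto simp: inverses_def)
    have "tgt \<Gamma> g = tgt \<Gamma> h" using h eq by (simp add: inverse_in_def)
    then have "g = h" using bisection_tgt_eqD[OF assms h(1,3)] by blast
    then show ?thesis using inverse_in_unique[OF arr[OF h(1)]] h by blast
  qed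
  show "x = y" if xy: "x \<in> inverses S" "y \<in> inverses S" and eq: "tgt \<Gamma> x = tgt \<Gamma> y" for x y
  proof -
    obtain g h where h: "g \<in> S" "inverse_in g x" "h \<in> S" "inverse_in h y"
      using xy by (auto simp: inverses_def)
    have "src \<Gamma> g = src \<Gamma> h" using h eq by (simp add: inverse_in_def)
    then have "g = h" using bisection_src_eqD[OF assms h(1,3)] by blast
    then show ?thesis using inverse_in_unique[OF arr[OF h(1)]] h by blast
  qed
  show "\<exists>x\<in>inverses S. src \<Gamma> x = m" if m: "m \<in> objs \<Gamma>" for m
  proof -
    obtain g where g: "g \<in> S" "tgt \<Gamma> g = m" using bisection_tgt_ex[OF assms m] by blast
    obtain h where "inverse_in g h" using inverse_in_ex[OF arr[OF g(1)]] by blast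
    then show ?thesis using g by (auto simp: inverses_def inverse_in_def)
  qed
  show "\<exists>x\<in>inverses S. tgt \<Gamma> x = m" if m: "m \<in> objs \<Gamma>" for m
  proof -
    obtain g where g: "g \<in> S" "src \<Gamma> g = m" using bisection_src_ex[OF assms m] by blast
    obtain h where "inverse_in g h" using inverse_in_ex[OF arr[OF g(1)]] by blast
    then show ?thesis using g by (auto simp: inverses_def inverse_in_def)
  qed
qed

lemma inverses_star:
  assumes "bisection \<Gamma> S"
  shows "star \<Gamma> (inverses S) S = ident \<Gamma> ` objs \<Gamma>"
proof (rule Set.set_eqI, rule iffI)
  note arr = bisection_arrs[OF assms]
  fix x
  {
    assume "x \<in> star \<Gamma> (inverses S) S"
    then obtain g h k where h: "g \<in> S" "inverse_in g h" "k \<in> S" "tgt \<Gamma> h = src \<Gamma> k" "x = gmul \<Gamma> h k"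
      by (auto simp: star_def inverses_def)
    have "g = k" using h bisection_src_eqD[OF assms] by (auto simp: inverse_in_def)
    then have "x = ident \<Gamma> (tgt \<Gamma> g)" using h by (auto simp: inverse_in_def)
    then show "x \<in> ident \<Gamma> ` objs \<Gamma>" using gpd_objs(2)[OF arr[OF h(1)]] by blast
  next
    assume "x \<in> ident \<Gamma> ` objs \<Gamma>"
    then obtain m where m: "m \<in> objs \<Gamma>" "x = ident \<Gamma> m" by blast
    obtain g where g: "g \<in> S" "tgt \<Gamma> g = m" using bisection_tgt_ex[OF assms m(1)] by blast
    obtain h where h: "inverse_in g h" using inverse_in_ex[OF arr[OF g(1)]] by blast
    have "x = gmul \<Gamma> h g" "tgt \<Gamma> h = src \<Gamma> g" "h \<in> inverses S"
      using h g m by (auto simp: inverse_in_def inverses_def)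
    then show "x \<in> star \<Gamma> (inverses S) S" using g unfolding star_def by blast
  }
qed

theorem group_Bis: "group (Bis \<Gamma>)"
proof (rule groupI)
  show "\<one>\<^bsub>Bis \<Gamma>\<^esub> \<in> carrier (Bis \<Gamma>)"
    using bisection_ident[OF gpd_precat] by (simp add: Bis_def)
  show "\<exists>y\<in>carrier (Bis \<Gamma>). y \<otimes>\<^bsub>Bis \<Gamma>\<^esub> x = \<one>\<^bsub>Bis \<Gamma>\<^esub>" if "x \<in> carrier (Bis \<Gamma>)" for x
    using that inverses_bisection[of x] inverses_star[of x] by (auto simp: Bis_def)
  have sub: "S \<subseteq> arrs \<Gamma>" if "S \<in> carrier (Bis \<Gamma>)" for S
    using that by (simp add: Bis_def bisection_def)
  show "x \<otimes>\<^bsub>Bis \<Gamma>\<^esub> y \<in> carrier (Bis \<Gamma>)"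
    if "x \<in> carrier (Bis \<Gamma>)" "y \<in> carrier (Bis \<Gamma>)" for x y
    using that star_bisection by (simp add: Bis_def)
  show "x \<otimes>\<^bsub>Bis \<Gamma>\<^esub> y \<otimes>\<^bsub>Bis \<Gamma>\<^esub> z = x \<otimes>\<^bsub>Bis \<Gamma>\<^esub> (y \<otimes>\<^bsub>Bis \<Gamma>\<^esub> z)"
    if "x \<in> carrier (Bis \<Gamma>)" "y \<in> carrier (Bis \<Gamma>)" "z \<in> carrier (Bis \<Gamma>)" for x y z
    using star_assoc[OF that[THEN sub]] by (simp add: Bis_def)
  show "\<one>\<^bsub>Bis \<Gamma>\<^esub> \<otimes>\<^bsub>Bis \<Gamma>\<^esub> x = x" if "x \<in> carrier (Bis \<Gamma>)" for x
    using star_one(1)[OF sub[OF that]] by (simp add: Bis_def)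
qed

lemma inv_Bis:
  assumes "bisection \<Gamma> S"
  shows "inv\<^bsub>Bis \<Gamma>\<^esub> S = inverses S"
  using group.inv_equality[OF group_Bis, of "inverses S" S] assms inverses_bisection inverses_star
  by (auto simp: Bis_def)

text \<open>With left-to-right products, the factor of a bisection composable with \<open>g\<close> on the left is
  the value of its section at the preimage of \<open>src g\<close> under the induced bijection.\<close>

theorem bis_conj_eq:
  assumes S: "bisection \<Gamma> S" and g: "g \<in> arrs \<Gamma>"
    and a: "a = bis_section \<Gamma> S (inv_into (objs \<Gamma>) (bis_base \<Gamma> S) (src \<Gamma> g))"
    and b: "b = bis_section \<Gamma> S (inv_into (objs \<Gamma>) (bis_base \<Gamma> S) (tgt \<Gamma> g))"
    and b': "b' \<in> arrs \<Gamma>" "src \<Gamma> b' = tgt \<Gamma> b" "tgt \<Gamma> b' = src \<Gamma> b"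
      "gmul \<Gamma> b b' = ident \<Gamma> (src \<Gamma> b)" "gmul \<Gamma> b' b = ident \<Gamma> (tgt \<Gamma> b)"
  shows "star \<Gamma> (star \<Gamma> S {g}) (inv\<^bsub>Bis \<Gamma>\<^esub> S) = {gmul \<Gamma> (gmul \<Gamma> a g) b'}"
    and "bis_conj \<Gamma> S g = gmul \<Gamma> (gmul \<Gamma> a g) b'"
proof -
  note arr = bisection_arrs[OF S]
  have sec: "bis_section \<Gamma> S (inv_into (objs \<Gamma>) (bis_base \<Gamma> S) m) \<in> S \<and>
      tgt \<Gamma> (bis_section \<Gamma> S (inv_into (objs \<Gamma>) (bis_base \<Gamma> S) m)) = m" if m: "m \<in> objs \<Gamma>" for m
  proof -
    obtain x where x: "x \<in> S" "tgt \<Gamma> x = m" using bisection_tgt_ex[OF S m] by blast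
    have "bis_section \<Gamma> S (src \<Gamma> x) = x"
      using bis_section[OF S gpd_objs(1)[OF arr[OF x(1)]]] x bisection_src_eqD[OF S] by blast
    then have "bis_base \<Gamma> S (src \<Gamma> x) = m" using x by (simp add: bis_base_def)
    then have "m \<in> bis_base \<Gamma> S ` objs \<Gamma>" using gpd_objs(1)[OF arr[OF x(1)]] by blast
    then have "inv_into (objs \<Gamma>) (bis_base \<Gamma> S) m \<in> objs \<Gamma>"
      "bis_base \<Gamma> S (inv_into (objs \<Gamma>) (bis_base \<Gamma> S) m) = m"
      by (auto intro: inv_into_into f_inv_into_f)
    then show ?thesis using bis_section[OF S] by (auto simp: bis_base_def)
  qed
  have aS: "a \<in> S" "tgt \<Gamma> a = src \<Gamma> g" and bS: "b \<in> S" "tgt \<Gamma> b = tgt \<Gamma> g"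
    using sec gpd_objs[OF g] a b by auto
  have inv: "inverse_in b b'" using b' by (simp add: inverse_in_def)
  have 1: "star \<Gamma> S {g} = {gmul \<Gamma> a g}"
  proof -
    have "c = a" if "c \<in> S" "tgt \<Gamma> c = src \<Gamma> g" for c
      using bisection_tgt_eqD[OF S that(1) aS(1)] that(2) aS(2) by simp
    then have "{c \<in> S. tgt \<Gamma> c = src \<Gamma> g} = {a}" using aS by blast
    moreover have "star \<Gamma> S {g} = (\<lambda>c. gmul \<Gamma> c g) ` {c \<in> S. tgt \<Gamma> c = src \<Gamma> g}"
      unfolding star_def by blast
    ultimately show ?thesis by simp
  qed
  have "x = b'" if x: "x \<in> inverses S" "src \<Gamma> x = tgt \<Gamma> g" for x
  proof -
    obtain k where k: "k \<in> S" "inverse_in k x" using x unfolding inverses_def by blast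
    have "k = b" using bisection_tgt_eqD[OF S k(1) bS(1)] k x bS by (simp add: inverse_in_def)
    then show ?thesis using inverse_in_unique[OF arr[OF bS(1)]] k inv by blast
  qed
  moreover have "b' \<in> inverses S" using bS(1) inv unfolding inverses_def by blast
  moreover have "src \<Gamma> b' = tgt \<Gamma> g" by (simp only: b'(2) bS(2))
  ultimately have 2: "{x \<in> inverses S. src \<Gamma> x = tgt \<Gamma> g} = {b'}" by blast
  have "tgt \<Gamma> (gmul \<Gamma> a g) = tgt \<Gamma> g" using gpd_comp(3)[OF arr[OF aS(1)] g] aS by simp
  moreover have "star \<Gamma> {d} B = gmul \<Gamma> d ` {x \<in> B. src \<Gamma> x = tgt \<Gamma> d}" for d B
    unfolding star_def image_def by (intro Collect_cong) (metis (mono_tags, lifting) mem_Collect_eq singletonD singletonI)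
  ultimately have "star \<Gamma> {gmul \<Gamma> a g} (inverses S) = {gmul \<Gamma> (gmul \<Gamma> a g) b'}"
    by (simp only: 2 image_insert image_empty)
  then show *: "star \<Gamma> (star \<Gamma> S {g}) (inv\<^bsub>Bis \<Gamma>\<^esub> S) = {gmul \<Gamma> (gmul \<Gamma> a g) b'}"
    unfolding 1 inv_Bis[OF S] .
  show "bis_conj \<Gamma> S g = gmul \<Gamma> (gmul \<Gamma> a g) b'"
    unfolding bis_conj_def * by simp
qed

end

end

theory Submission
  imports Defs
begin

text \<open>Conjugation by a bisection \<open>\<Sigma>\<close> of \<open>\<Gamma>\<close> moves the source and target of an arrow by the
  inverse of the induced bijection of the object set (\<open>bis_base_src_tgt_conj\<close>), because
  products are read from left to right; a rackoid asks instead for the bijection itself. The two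
  requirements agree here: applying \<open>p\<close> to the hypothesis that \<open>p(\<Sigma>)\<close> fixes the unit \<open>1\<^sub>m\<close>, for
  \<open>\<Sigma>\<close> a bisection of \<open>X\<close>, says that conjugation by \<open>p(\<Sigma>)\<close> fixes the unit of \<open>\<Gamma>\<close> at \<open>m\<close>, so
  every bisection of \<open>X\<close> induces the identity on objects. This gives the source, target and
  unit axioms.

  Self-distributivity is the usual fact about conjugation. The compatibility of \<open>p\<close> with the action
  turns \<open>p(\<Sigma> \<rhd> T)\<close> into the conjugate bisection \<open>p(\<Sigma>) \<star> p(T) \<star> p(\<Sigma>)\<^sup>-\<^sup>1\<close>
  (\<open>image_bis_conj\<close>), and acting with this on \<open>p(\<Sigma>) \<cdot> x\<close> gives \<open>(p(\<Sigma>) \<star> p(T)) \<cdot> x\<close>.\<close>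

lemma bis_base_src:
  assumes "precategory C" "bisection C S" "c \<in> S"
  shows "bis_base C S (src C c) = tgt C c"
proof -
  have "src C c \<in> objs C"
    using assms by (auto simp: precategory_def bisection_def)
  then have "bis_section C S (src C c) = c"
    using bis_section[OF assms(2)] bisection_src_eqD[OF assms(2)] assms(3) by blast
  then show ?thesis by (simp add: bis_base_def)
qed

lemma bij_betw_bis_base:
  assumes "bisection C S"
  shows "bij_betw (bis_base C S) (objs C) (objs C)"
proof -
  have "bij_betw (tgt C \<circ> the_inv_into S (src C)) (objs C) (objs C)"
    using assms bij_betw_the_inv_into bij_betw_trans unfolding bisection_def by blast
  moreover have "tgt C \<circ> the_inv_into S (src C) = bis_base C S"
    by (simp add: fun_eq_iff bis_base_def bis_section_def)
  ultimately show ?thesis by simp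
qed

lemma bis_base_morphism:
  assumes "precategory C" "precategory D" "precat_morphism C D p" "bisection C S" "m \<in> objs C"
  shows "bis_base D (p ` S) m = bis_base C S m"
proof -
  obtain c where c: "c \<in> S" "src C c = m"
    using bisection_src_ex[OF assms(4,5)] by blast
  have "src D (p c) = src C c" "tgt D (p c) = tgt C c"
    using assms(3) bisection_arrs[OF assms(4) c(1)] by (auto simp: precat_morphism_def)
  then show ?thesis
    using bis_base_src[OF assms(1,4) c(1)] c
      bis_base_src[OF assms(2) bisection_image[OF assms(3,4)] imageI[OF c(1)]] by simp
qed

text \<open>This justifies the definite description in the definition of \<open>bis_conj\<close>: the conjugate
  exists and is unique for every arrow.\<close>

lemma star_singleton_conj:
  assumes G: "groupoid \<Gamma>" and S: "bisection \<Gamma> S" and g: "g \<in> arrs \<Gamma>"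
  shows "star \<Gamma> (star \<Gamma> S {g}) (inv\<^bsub>Bis \<Gamma>\<^esub> S) = {bis_conj \<Gamma> S g}"
proof -
  define b where "b = bis_section \<Gamma> S (inv_into (objs \<Gamma>) (bis_base \<Gamma> S) (tgt \<Gamma> g))"
  have "inv_into (objs \<Gamma>) (bis_base \<Gamma> S) (tgt \<Gamma> g) \<in> objs \<Gamma>"
    using bij_betw_bis_base[OF S] gpd_objs(2)[OF G g] by (metis bij_betw_def inv_into_into)
  then have "b \<in> arrs \<Gamma>"
    using bis_section(1)[OF S] bisection_arrs[OF S] by (auto simp: b_def)
  then obtain b' where "inverse_in \<Gamma> b b'" using inverse_in_ex[OF G] by blast
  then have b': "b' \<in> arrs \<Gamma>" "src \<Gamma> b' = tgt \<Gamma> b" "tgt \<Gamma> b' = src \<Gamma> b"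
      "gmul \<Gamma> b b' = ident \<Gamma> (src \<Gamma> b)" "gmul \<Gamma> b' b = ident \<Gamma> (tgt \<Gamma> b)"
    by (simp_all add: inverse_in_def[OF G])
  show ?thesis using bis_conj_eq[OF G S g refl b_def b'] by simp
qed

text \<open>In a conjugate \<open>c g d\<close> with \<open>c\<close> in \<open>S\<close> and \<open>d\<close> the inverse of some \<open>k\<close> in \<open>S\<close>, the arrow
  \<open>c\<close> ends where \<open>g\<close> starts and \<open>k\<close> ends where \<open>g\<close> ends.\<close>

lemma bis_base_src_tgt_conj:
  assumes G: "groupoid \<Gamma>" and S: "bisection \<Gamma> S" and g: "g \<in> arrs \<Gamma>"
  shows "bis_base \<Gamma> S (src \<Gamma> (bis_conj \<Gamma> S g)) = src \<Gamma> g"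
    and "bis_base \<Gamma> S (tgt \<Gamma> (bis_conj \<Gamma> S g)) = tgt \<Gamma> g"
proof -
  have "bis_conj \<Gamma> S g \<in> star \<Gamma> (star \<Gamma> S {g}) (inverses \<Gamma> S)"
    using star_singleton_conj[OF G S g] inv_Bis[OF G S] by simp
  then obtain c d where cd: "c \<in> S" "tgt \<Gamma> c = src \<Gamma> g" "d \<in> inverses \<Gamma> S"
      "tgt \<Gamma> (gmul \<Gamma> c g) = src \<Gamma> d" "bis_conj \<Gamma> S g = gmul \<Gamma> (gmul \<Gamma> c g) d"
    by (auto simp: star_def)
  obtain k where k: "k \<in> S" "inverse_in \<Gamma> k d"
    using cd(3) by (auto simp: inverses_def[OF G])
  have d: "d \<in> arrs \<Gamma>" "src \<Gamma> d = tgt \<Gamma> k" "tgt \<Gamma> d = src \<Gamma> k"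
    using k(2) by (simp_all add: inverse_in_def[OF G])
  note cg = gpd_comp[OF G bisection_arrs[OF S cd(1)] g cd(2)]
  note cgd = gpd_comp[OF G cg(1) d(1) cd(4)]
  show "bis_base \<Gamma> S (src \<Gamma> (bis_conj \<Gamma> S g)) = src \<Gamma> g"
    using bis_base_src[OF gpd_precat[OF G] S cd(1)] cd(2,5) cg(2) cgd(2) by simp
  show "bis_base \<Gamma> S (tgt \<Gamma> (bis_conj \<Gamma> S g)) = tgt \<Gamma> g"
    using bis_base_src[OF gpd_precat[OF G] S k(1)] cd(4,5) cg(3) cgd(3) d by simp
qed

lemma image_bis_conj:
  assumes G: "groupoid \<Gamma>" and S: "bisection \<Gamma> S" and A: "A \<subseteq> arrs \<Gamma>"
  shows "bis_conj \<Gamma> S ` A = star \<Gamma> (star \<Gamma> S A) (inv\<^bsub>Bis \<Gamma>\<^esub> S)"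
proof -
  have "star \<Gamma> (star \<Gamma> S A) B = (\<Union>g\<in>A. star \<Gamma> (star \<Gamma> S {g}) B)" for B
    unfolding star_def by blast
  then have "star \<Gamma> (star \<Gamma> S A) (inv\<^bsub>Bis \<Gamma>\<^esub> S) = (\<Union>g\<in>A. {bis_conj \<Gamma> S g})"
    using star_singleton_conj[OF G S] A by (simp add: subset_iff)
  then show ?thesis by blast
qed

theorem theorem2p14:
  fixes \<Gamma> :: "('m, 'g) gpd"
    and X :: "('m, 'x) precat"
    and p :: "'x \<Rightarrow> 'g"
    and act :: "'g set \<Rightarrow> 'x \<Rightarrow> 'x"
  assumes "groupoid \<Gamma>"
    and "precategory X"
    and "objs X = objs \<Gamma>"
    and "precat_morphism X \<Gamma> p"
    and "group_action (Bis \<Gamma>) (arrs X) act"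
    and "\<And>S x. S \<in> carrier (Bis \<Gamma>) \<Longrightarrow> x \<in> arrs X \<Longrightarrow> p (act S x) = bis_conj \<Gamma> S (p x)"
    and "\<And>S m. bisection X S \<Longrightarrow> m \<in> objs X \<Longrightarrow> act (p ` S) (ident X m) = ident X m"
  shows "pointed_rackoid X (\<lambda>T x. act (p ` T) x)"
proof -
  note G = assms(1) and X = assms(2) and ob = assms(3) and mor = assms(4)
  interpret A: group_action "Bis \<Gamma>" "arrs X" act by (fact assms(5))
  interpret B: group "Bis \<Gamma>" by (rule group_Bis[OF G])
  have p: "p x \<in> arrs \<Gamma>" "src \<Gamma> (p x) = src X x" "tgt \<Gamma> (p x) = tgt X x"
    if "x \<in> arrs X" for x
    using mor that by (auto simp: precat_morphism_def)
  have p_ident: "p (ident X m) = ident \<Gamma> m" if "m \<in> objs X" for m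
    using mor that by (simp add: precat_morphism_def)
  have ident: "ident X m \<in> arrs X" if "m \<in> objs X" for m
    using X that by (auto simp: precategory_def)
  have ends: "src X x \<in> objs X" "tgt X x \<in> objs X" if "x \<in> arrs X" for x
    using X that by (auto simp: precategory_def)
  have bis: "bisection \<Gamma> (p ` S)" if "bisection X S" for S
    by (rule bisection_image[OF mor that])
  have carr: "p ` S \<in> carrier (Bis \<Gamma>)" if "bisection X S" for S
    using bis[OF that] by (simp add: Bis_def)
  have closed: "act (p ` S) x \<in> arrs X" if "bisection X S" "x \<in> arrs X" for S x
    using A.element_image[OF carr[OF that(1)] that(2)] by simp

  \<comment> \<open>The fixed units \<open>1\<^sub>m\<close> force every bisection of \<open>X\<close> to induce the identity on objects.\<close>
  have base_\<Gamma>: "bis_base \<Gamma> (p ` S) m = m" if S: "bisection X S" and m: "m \<in> objs X" for S m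
  proof -
    have "bis_conj \<Gamma> (p ` S) (ident \<Gamma> m) = ident \<Gamma> m"
      using assms(6)[OF carr[OF S] ident[OF m]] assms(7)[OF S m] p_ident[OF m] by simp
    then show ?thesis
      using bis_base_src_tgt_conj(1)[OF G bis[OF S], of "ident \<Gamma> m"] gpd_ident[OF G] m ob by simp
  qed
  then have base: "bis_base X S m = m" if "bisection X S" "m \<in> objs X" for S m
    using bis_base_morphism[OF X gpd_precat[OF G] mor that] that by simp

  have src_tgt: "src X (act (p ` S) x) = src X x \<and> tgt X (act (p ` S) x) = tgt X x"
    if S: "bisection X S" and x: "x \<in> arrs X" for S x
  proof -
    note y = closed[OF S x]
    have eq: "p (act (p ` S) x) = bis_conj \<Gamma> (p ` S) (p x)"
      by (rule assms(6)[OF carr[OF S] x])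
    show ?thesis
      using bis_base_src_tgt_conj[OF G bis[OF S] p(1)[OF x]] p[OF x] p[OF y]
        base_\<Gamma>[OF S ends(1)[OF y]] base_\<Gamma>[OF S ends(2)[OF y]]
      by (simp flip: eq)
  qed

  have distrib: "act (p ` S) (act (p ` T) x) =
      act (p ` (act (p ` S) ` T)) (act (p ` S) x)"
    if S: "bisection X S" and T: "bisection X T" and x: "x \<in> arrs X" for S T x
  proof -
    have T_arrs: "t \<in> arrs X" if "t \<in> T" for t using bisection_arrs[OF T that] .
    have "p ` (act (p ` S) ` T) = bis_conj \<Gamma> (p ` S) ` (p ` T)"
      using assms(6)[OF carr[OF S] T_arrs] by (simp add: image_image)
    also have "\<dots> = p ` S \<otimes>\<^bsub>Bis \<Gamma>\<^esub> p ` T \<otimes>\<^bsub>Bis \<Gamma>\<^esub> inv\<^bsub>Bis \<Gamma>\<^esub> (p ` S)"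
      using image_bis_conj[OF G bis[OF S], of "p ` T"] p(1) T_arrs by (auto simp: Bis_def)
    finally have conj: "p ` (act (p ` S) ` T) =
        p ` S \<otimes>\<^bsub>Bis \<Gamma>\<^esub> p ` T \<otimes>\<^bsub>Bis \<Gamma>\<^esub> inv\<^bsub>Bis \<Gamma>\<^esub> (p ` S)" .
    have "act (p ` (act (p ` S) ` T)) (act (p ` S) x) =
        act (p ` (act (p ` S) ` T) \<otimes>\<^bsub>Bis \<Gamma>\<^esub> p ` S) x"
      using A.composition_rule[OF x, of "p ` (act (p ` S) ` T)" "p ` S"] carr[OF S] carr[OF T]
      by (simp add: conj)
    also have "p ` (act (p ` S) ` T) \<otimes>\<^bsub>Bis \<Gamma>\<^esub> p ` S = p ` S \<otimes>\<^bsub>Bis \<Gamma>\<^esub> p ` T"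
      using carr[OF S] carr[OF T] by (simp add: conj B.m_assoc)
    finally show ?thesis
      using A.composition_rule[OF x carr[OF S] carr[OF T]] by simp
  qed

  have "p ` ident X ` objs X = \<one>\<^bsub>Bis \<Gamma>\<^esub>"
    using p_ident ob by (simp add: Bis_def image_image)
  then have unit: "act (p ` ident X ` objs X) x = x" if "x \<in> arrs X" for x
    using A.id_eq_one that by (metis restrict_apply')

  have "bij_betw (act (p ` S)) (arrs X) (arrs X)" if "bisection X S" for S
    using A.inj_prop[OF carr[OF that]] A.surj_prop[OF carr[OF that]]
    by (simp add: bij_betw_def)
  then show ?thesis
    unfolding pointed_rackoid_def
    using X src_tgt base ends distrib unit assms(7) by simp
qed

end
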